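(* Let $T$ be a total order on the sample space $\Omega$ and let $B_T^*$ be the conditionally optimal lower bound for $T$. Assume that $B_T^*$ is injective, i.e. takes a distinct value at each $x\in\Omega$. Then $B_T^*$ is admissible with respect to the full family of lower bounds on $\Omega$.
   Context: Fix a finite nonempty set $S\subset\mathbb{R}$, an integer $n\ge 1$ and $\alpha\in(0,1)$ (the confidence level is $1-\alpha$). The sample space is $\Omega=\Omega(S,n)=\{(x_1,\dots,x_n)\in S^n: x_1\le\dots\le x_n\}$, with $N=|\Omega|$. $\mathcal{F}=\mathcal{F}(S)$ is the closed simplex of all probability distributions on $S$ (zero masses allowed), with the Euclidean topology on mass vectors, and $\mu(F)=\sum_{s\in S}sF(s)$. For $x\in\Omega$ containing $\hat x_s$ copies of $s$, $\Pr_F(x)=\frac{n!}{\prod_{s}\hat x_s!}\prod_{s\in S}F(s)^{\hat x_s}$ (with $0^0=1$), and $\Pr_F(A)=\sum_{x\in A}\Pr_F(x)$ for $A\subseteq\Omega$. A lower bound is any map $B:\Omega\to[-\infty,\infty]$. It is valid if $\Pr_F(\{x\in\Omega: B(x)>\mu(F)\})\le\alpha$ for every $F\in\mathcal{F}$. For valid bounds, $B_1$ dominates $B_2$ if $B_1(x)\ge B_2(x)$ for all $x\in\Omega$ with strict inequality for at least one $x$. A bound $B$ is admissible if it is valid and no valid bound dominates it. A total order $T$ on $\Omega$ is an enumeration $(x_{t_1},\dots,x_{t_N})$ of $\Omega$; a bound $B$ is consistent with $T$ if $B(x_{t_1})\le\dots\le B(x_{t_N})$. The conditionally optimal bound $B_T^*$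 for $T$ is the (unique) valid bound consistent with $T$ that dominates every other valid bound consistent with $T$. Classically (Buehler) it exists and is given by $B_T^*(x_{t_k})=\min_{F\in\mathcal{F}_k}\mu(F)$ if $\mathcal{F}_k\neq\emptyset$ and $B_T^*(x_{t_k})=\infty$ if $\mathcal{F}_k=\emptyset$, where $\Omega_k=\{x_{t_k},\dots,x_{t_N}\}$ and $\mathcal{F}_k$ is the closure of $\{F\in\mathcal{F}:\Pr_F(\Omega_k)>\alpha\}$. *)

theory Defs
  imports "HOL-Probability.Probability_Mass_Function"
begin

text \<open>
  Order statistics of an \<open>n\<close>-sample from \<open>S\<close> are sorted lists. A distribution on \<open>S\<close> is a
  \<^typ>\<open>real pmf\<close> supported in \<open>S\<close> (points of \<open>S\<close> may have mass zero). A lower bound is a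
  function \<^typ>\<open>real list \<Rightarrow> ereal\<close> of which only the values on the sample space matter.
\<close>

definition sample_space :: "real set \<Rightarrow> nat \<Rightarrow> real list set" where
  "sample_space S n = {x. length x = n \<and> sorted x \<and> set x \<subseteq> S}"

definition distributions :: "real set \<Rightarrow> real pmf set" where
  "distributions S = {F. set_pmf F \<subseteq> S}"

definition mean :: "real set \<Rightarrow> real pmf \<Rightarrow> real" where
  "mean S F = (\<Sum>s\<in>S. s * pmf F s)"

definition sample_prob :: "real set \<Rightarrow> nat \<Rightarrow> real pmf \<Rightarrow> real list \<Rightarrow> real" where
  "sample_prob S n F x =
     fact n / (\<Prod>s\<in>S. fact (count_list x s)) * (\<Prod>s\<in>S. pmf F s ^ count_list x s)"

definition event_prob :: "real set \<Rightarrow> nat \<Rightarrow> real pmf \<Rightarrow> real list set \<Rightarrow> real" where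
  "event_prob S n F A = (\<Sum>x\<in>A. sample_prob S n F x)"

definition valid_bound :: "real set \<Rightarrow> nat \<Rightarrow> real \<Rightarrow> (real list \<Rightarrow> ereal) \<Rightarrow> bool" where
  "valid_bound S n \<alpha> B \<longleftrightarrow>
     (\<forall>F\<in>distributions S.
        event_prob S n F {x \<in> sample_space S n. B x > ereal (mean S F)} \<le> \<alpha>)"

definition dominates ::
  "real set \<Rightarrow> nat \<Rightarrow> (real list \<Rightarrow> ereal) \<Rightarrow> (real list \<Rightarrow> ereal) \<Rightarrow> bool" where
  "dominates S n B1 B2 \<longleftrightarrow>
     (\<forall>x\<in>sample_space S n. B1 x \<ge> B2 x) \<and> (\<exists>x\<in>sample_space S n. B1 x > B2 x)"

definition admissible :: "real set \<Rightarrow> nat \<Rightarrow> real \<Rightarrow> (real list \<Rightarrow> ereal) \<Rightarrow> bool" where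
  "admissible S n \<alpha> B \<longleftrightarrow>
     valid_bound S n \<alpha> B \<and> \<not> (\<exists>B'. valid_bound S n \<alpha> B' \<and> dominates S n B' B)"

definition is_total_order :: "real set \<Rightarrow> nat \<Rightarrow> real list list \<Rightarrow> bool" where
  "is_total_order S n T \<longleftrightarrow> distinct T \<and> set T = sample_space S n"

definition consistent :: "real list list \<Rightarrow> (real list \<Rightarrow> ereal) \<Rightarrow> bool" where
  "consistent T B \<longleftrightarrow> sorted (map B T)"

text \<open>
  \<open>B\<close> is the conditionally optimal bound for \<open>T\<close>. Bounds that agree on the sample space are the
  same bound, so ``every other bound'' means every bound that differs from \<open>B\<close> somewhere on it.
  Existence and uniqueness are proved below.
\<close>

definition conditionally_optimal ::
  "real set \<Rightarrow> nat \<Rightarrow> real \<Rightarrow> real list list \<Rightarrow> (real list \<Rightarrow> ereal) \<Rightarrow> bool" where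
  "conditionally_optimal S n \<alpha> T B \<longleftrightarrow>
     valid_bound S n \<alpha> B \<and> consistent T B \<and>
     (\<forall>B'. valid_bound S n \<alpha> B' \<and> consistent T B' \<and> (\<exists>x\<in>sample_space S n. B' x \<noteq> B x)
        \<longrightarrow> dominates S n B B')"

lemma conditionally_optimal_unique:
  assumes "conditionally_optimal S n \<alpha> T B" "conditionally_optimal S n \<alpha> T B'"
    and "x \<in> sample_space S n"
  shows "B x = B' x"
proof (rule ccontr)
  assume "B x \<noteq> B' x"
  then have "dominates S n B B'" "dominates S n B' B"
    using assms unfolding conditionally_optimal_def by metis+
  then show False
    unfolding dominates_def by (meson leD)
qed

lemma event_prob_mono:
  assumes "finite A'" "A \<subseteq> A'"
  shows "event_prob S n F A \<le> event_prob S n F A'"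
  unfolding event_prob_def sample_prob_def
  using assms by (intro sum_mono2) (auto intro!: mult_nonneg_nonneg divide_nonneg_nonneg prod_nonneg)

lemma conditionally_optimal_exists:
  assumes T: "is_total_order S n T" and "0 < \<alpha>"
  shows "\<exists>B. conditionally_optimal S n \<alpha> T B"
proof -
  define V where "V = {B. valid_bound S n \<alpha> B \<and> consistent T B}"
  define M where "M x = (SUP B\<in>V. B x)" for x
  have set_T: "set T = sample_space S n"
    using T by (simp add: is_total_order_def)
  then have fin: "finite (sample_space S n)"
    by (metis List.finite_set)
  have upper: "B x \<le> M x" if "B \<in> V" for B x
    unfolding M_def using that by (rule SUP_upper)
  have mono_V: "B (T ! i) \<le> B (T ! j)" if "B \<in> V" "i \<le> j" "j < length T" for B i j
    using that sorted_nth_mono[of "map B T" i j] by (simp add: V_def consistent_def)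
  have "consistent T M"
    unfolding consistent_def sorted_iff_nth_mono M_def by (auto intro!: SUP_mono mono_V)
  moreover have "valid_bound S n \<alpha> M"
    unfolding valid_bound_def
  proof
    fix F assume F: "F \<in> distributions S"
    let ?A = "\<lambda>B. {x \<in> sample_space S n. B x > ereal (mean S F)}"
    let ?P = "\<lambda>k. k < length T \<and> M (T ! k) > ereal (mean S F)"
    show "event_prob S n F (?A M) \<le> \<alpha>"
    proof (cases "\<exists>k. ?P k")
      case False
      then have "?A M = {}"
        unfolding set_T[symmetric] by (auto simp: in_set_conv_nth)
      then show ?thesis
        using \<open>0 < \<alpha>\<close> by (simp only: event_prob_def) simp
    next
      case True
      define k where "k = (LEAST k. ?P k)"
      have k: "?P k"
        unfolding k_def using True by (rule LeastI_ex)
      then obtain B where B: "B \<in> V" "B (T ! k) > ereal (mean S F)"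
        by (auto simp: M_def less_SUP_iff)
      have "?A M \<subseteq> ?A B"
      proof
        fix x assume x: "x \<in> ?A M"
        then obtain j where j: "j < length T" "x = T ! j"
          unfolding set_T[symmetric] by (auto simp: in_set_conv_nth)
        then have "k \<le> j"
          unfolding k_def using x by (intro Least_le) auto
        then show "x \<in> ?A B"
          using x j B mono_V[of B k j] by (auto intro: less_le_trans)
      qed
      then have "event_prob S n F (?A M) \<le> event_prob S n F (?A B)"
        using fin by (intro event_prob_mono) auto
      also have "\<dots> \<le> \<alpha>"
        using B F by (auto simp: V_def valid_bound_def)
      finally show ?thesis .
    qed
  qed
  moreover have "dominates S n M B'"
    if "valid_bound S n \<alpha> B'" "consistent T B'" "\<exists>x\<in>sample_space S n. B' x \<noteq> M x" for B'
    using that upper[of B'] unfolding dominates_def V_def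
    by (metis (mono_tags, lifting) mem_Collect_eq order_le_less)
  ultimately show ?thesis
    unfolding conditionally_optimal_def by blast
qed

end

theory Submission
  imports Defs
begin

text \<open>
  Suppose a valid bound \<open>B'\<close> dominates \<open>B\<close>, with \<open>B' y > B y\<close>. The bound \<open>B'\<close> need not be
  consistent with \<open>T\<close>, so it cannot be compared with \<open>B\<close> by conditional optimality directly. But
  since \<open>B\<close> is injective, every point after \<open>y\<close> in \<open>T\<close> has a strictly larger value, so \<open>B\<close> can be
  raised at the single point \<open>y\<close> without disturbing the order, as long as the new value does not
  exceed the next larger one. If the new value does not exceed \<open>B' y\<close> either, then the raised
  bound lies below \<open>B'\<close> and is therefore valid (\<open>valid_bound_antimono\<close>). It is then valid,
  consistent with \<open>T\<close> (\<open>consistent_transfer\<close>) and strictly larger than \<open>B\<close> at \<open>y\<close>, contrary to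
  the conditional optimality of \<open>B\<close>.
\<close>

text \<open>
  Lowering a bound shrinks each event on which it exceeds the mean. Finiteness is needed because
  a sum over an infinite set is zero.
\<close>

lemma valid_bound_antimono:
  assumes fin: "finite (sample_space S n)"
    and valid: "valid_bound S n \<alpha> B'"
    and le: "\<And>x. x \<in> sample_space S n \<Longrightarrow> C x \<le> B' x"
  shows "valid_bound S n \<alpha> C"
  unfolding valid_bound_def
proof
  fix F assume F: "F \<in> distributions S"
  have "event_prob S n F {x \<in> sample_space S n. C x > ereal (mean S F)}
      \<le> event_prob S n F {x \<in> sample_space S n. B' x > ereal (mean S F)}"
    using fin le by (intro event_prob_mono) (auto intro: less_le_trans)
  also have "\<dots> \<le> \<alpha>"
    using valid F by (simp add: valid_bound_def)
  finally show "event_prob S n F {x \<in> sample_space S n. C x > ereal (mean S F)} \<le> \<alpha>" .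
qed

text \<open>
  An earlier entry of \<open>T\<close> never has the larger value under \<open>B\<close>, so the consistency of \<open>C\<close> can be
  checked by comparing values, with no reference to positions in \<open>T\<close>.
\<close>

lemma consistent_transfer:
  assumes "consistent T B"
    and "\<And>x z. x \<in> set T \<Longrightarrow> z \<in> set T \<Longrightarrow> B x \<le> B z \<Longrightarrow> C x \<le> C z"
  shows "consistent T C"
  using assms unfolding consistent_def sorted_map
  by (rule sorted_wrt_mono_rel[rotated])

theorem lemma3p4:
  fixes S :: "real set" and n :: nat and \<alpha> :: real
    and T :: "real list list" and B :: "real list \<Rightarrow> ereal"
  assumes "finite S" and "S \<noteq> {}" and "n \<ge> 1" and "0 < \<alpha>" and "\<alpha> < 1"
    and "is_total_order S n T"
    and "conditionally_optimal S n \<alpha> T B"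
    and "inj_on B (sample_space S n)"
  shows "admissible S n \<alpha> B"
proof -
  let ?\<Omega> = "sample_space S n"
  have set_T: "set T = ?\<Omega>"
    using assms(6) by (simp add: is_total_order_def)
  then have fin: "finite ?\<Omega>"
    by (metis List.finite_set)
  have valid: "valid_bound S n \<alpha> B" and cons: "consistent T B"
    using assms(7) by (auto simp: conditionally_optimal_def)
  have False if B': "valid_bound S n \<alpha> B'" and dom: "dominates S n B' B" for B'
  proof -
    obtain y where y: "y \<in> ?\<Omega>" "B y < B' y"
      using dom by (auto simp: dominates_def)
    define V where "V = insert (B' y) (B ` {z \<in> ?\<Omega>. B y < B z})"
    define C where "C = B(y := Min V)"
    have V: "finite V" "V \<noteq> {}"
      using fin by (auto simp: V_def)
    have gt: "B y < C y"
      using V y by (auto simp: C_def V_def)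
    have le_B': "C x \<le> B' x" if "x \<in> ?\<Omega>" for x
      using V dom that by (auto simp: C_def V_def dominates_def intro: Min_le)
    have mono: "C x \<le> C z" if "x \<in> ?\<Omega>" "z \<in> ?\<Omega>" "B x \<le> B z" for x z
    proof (cases "x = y \<and> z \<noteq> y")
      case True
      \<comment> \<open>The only place where injectivity enters: without it, \<open>z\<close> could tie with \<open>y\<close>.\<close>
      then have "B y < B z"
        using that assms(8) by (auto simp: inj_on_def order.strict_iff_order)
      then have "B z \<in> V"
        using that by (simp add: V_def)
      then show ?thesis
        using True V by (simp add: C_def)
    next
      case False
      then show ?thesis
        using that gt by (cases "z = y") (auto simp: C_def)
    qed
    have "valid_bound S n \<alpha> C"
      using fin B' le_B' by (rule valid_bound_antimono)
    moreover have "consistent T C"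
      using cons mono by (rule consistent_transfer) (simp_all add: set_T)
    ultimately have "dominates S n B C"
      using assms(7) y gt unfolding conditionally_optimal_def by (metis less_irrefl)
    then show False
      using y gt by (auto simp: dominates_def dest: leD)
  qed
  then show ?thesis
    using valid by (auto simp: admissible_def)
qed

end
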